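(* Let $\omega_0,C\in\mathbb R$ and suppose that $$\frac1{|e^{2\pi i\omega_0l}-1|}\le c_1l^2\quad\text{for all positive integers }l.$$ Let $\theta_n=\{\omega_0n^2-C\}$, $n\ge1$. Then there is a constant $c$ depending only on $c_1$ such that $$\frac1N\sum_{1\le n\le N,\ \theta_n\in[0,\rho]}1\le c\rho\quad\text{for all }\rho\in(0,1/4)\text{ and all integers }N>\rho^{-78}.$$
   Context: $\{x\}=x-[x]\in[0,1)$ denotes the fractional part of $x\in\mathbb R$. The sum counts the integers $n\in\{1,\dots,N\}$ with $\theta_n\in[0,\rho]$. *)

theory Defs
  imports "HOL-Analysis.Analysis"
begin

definition theta :: "real \<Rightarrow> real \<Rightarrow> nat \<Rightarrow> real" where
  "theta \<omega>\<^sub>0 C n = frac (\<omega>\<^sub>0 * (real n)\<^sup>2 - C)"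

text \<open>The conjunct \<open>exp \<dots> \<noteq> 1\<close> makes explicit that the left-hand side of the
  inequality is a finite number. Without it, the convention \<open>1 / 0 = 0\<close> would make the bound
  hold vacuously whenever \<open>\<omega>\<^sub>0 * l\<close> is an integer.\<close>

definition diophantine :: "real \<Rightarrow> real \<Rightarrow> bool" where
  "diophantine c\<^sub>1 \<omega>\<^sub>0 \<longleftrightarrow>
     (\<forall>l::nat. l \<ge> 1 \<longrightarrow>
        exp (2 * complex_of_real pi * \<i> * complex_of_real \<omega>\<^sub>0 * of_nat l) \<noteq> 1 \<and>
        1 / norm (exp (2 * complex_of_real pi * \<i> * complex_of_real \<omega>\<^sub>0 * of_nat l) - 1)
          \<le> c\<^sub>1 * (real l)\<^sup>2)"

end

theory Submission
  imports Defs
begin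

text \<open>Let \<open>e(x)\<close> denote the complex number \<open>cis (2\<pi>x)\<close>.
  If \<open>\<theta>\<^sub>n \<in> [0,\<rho>]\<close> and \<open>6K\<rho> \<le> 1\<close>, then all \<open>e(j\<theta>\<^sub>n)\<close> with \<open>j < K\<close> have real part at least \<open>1/2\<close>,
  so \<open>|\<Sum>\<^sub>j e(j\<theta>\<^sub>n)|\<^sup>2 \<ge> K\<^sup>2/4\<close>. Summing over \<open>n\<close> and expanding the square bounds the count by the
  Weyl sums \<open>\<Sum>\<^sub>n e(k\<theta>\<^sub>n)\<close> with \<open>0 < |k| < K\<close>. In such a sum, average over the \<open>H = K\<^sup>2\<close> shifts
  \<open>n \<mapsto> n + h\<close>, apply Cauchy-Schwarz and expand the square again: this leaves geometric sums with
  ratio \<open>e(2k(h - h')\<omega>\<^sub>0)\<close>, which the Diophantine condition bounds independently of \<open>N\<close>.\<close>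

text \<open>Expanding the square leaves correlations between pairs of indices: the J diagonal ones
  equal \<open>card A\<close> by unimodularity, and the others are at most \<open>B\<close>. It
  serves twice, for multiples of \<theta> and for shifts in a Weyl sum.\<close>

lemma sum_norm_square_le_offdiagonal:
  fixes f :: "nat \<Rightarrow> 'a \<Rightarrow> complex"
  assumes unit: "\<And>j n. norm (f j n) = 1" and "0 \<le> B"
    and off: "\<And>i j. i < J \<Longrightarrow> j < J \<Longrightarrow> i \<noteq> j \<Longrightarrow> norm (\<Sum>n\<in>A. f i n * cnj (f j n)) \<le> B"
  shows "(\<Sum>n\<in>A. (norm (\<Sum>j<J. f j n))\<^sup>2) \<le> real J * real (card A) + (real J)\<^sup>2 * B"
proof -
  have "complex_of_real (\<Sum>n\<in>A. (norm (\<Sum>j<J. f j n))\<^sup>2)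
      = (\<Sum>n\<in>A. \<Sum>i<J. \<Sum>j<J. f i n * cnj (f j n))"
    by (simp add: complex_norm_square sum_product del: of_real_power)
  also have "\<dots> = (\<Sum>i<J. \<Sum>j<J. \<Sum>n\<in>A. f i n * cnj (f j n))"
    by (subst sum.swap, intro sum.cong refl, rule sum.swap)
  finally have eq: "complex_of_real (\<Sum>n\<in>A. (norm (\<Sum>j<J. f j n))\<^sup>2)
      = (\<Sum>i<J. \<Sum>j<J. \<Sum>n\<in>A. f i n * cnj (f j n))" .
  have "(\<Sum>n\<in>A. (norm (\<Sum>j<J. f j n))\<^sup>2) \<le> norm (complex_of_real (\<Sum>n\<in>A. (norm (\<Sum>j<J. f j n))\<^sup>2))"
    unfolding norm_of_real by (rule abs_ge_self)
  \<comment> \<open>\<open>B\<close> is added on the diagonal as well, which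
    \<open>0 \<le> B\<close> permits; this gives the simple factor J^2.\<close>
  also have "\<dots> \<le> (\<Sum>i<J. \<Sum>j<J. (if i = j then real (card A) else 0) + B)"
    unfolding eq
  proof (intro sum_norm_le)
    fix i j assume ij: "i \<in> {..<J}" "j \<in> {..<J}"
    have diag: "f i n * cnj (f i n) = 1" for i n
      using unit[of i n] complex_norm_square[of "f i n"] by simp
    show "norm (\<Sum>n\<in>A. f i n * cnj (f j n)) \<le> (if i = j then real (card A) else 0) + B"
      using off[of i j] ij \<open>0 \<le> B\<close> by (cases "i = j") (simp_all add: diag)
  qed
  also have "\<dots> = real J * real (card A) + (real J)\<^sup>2 * B"
    by (simp add: sum.distrib power2_eq_square distrib_left)
  finally show ?thesis .
qed

lemma norm_cis_minus_1_neg: "norm (cis (- x) - 1) = norm (cis x - 1)"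
  using complex_mod_cnj[of "cis x - 1"] by (simp add: cis_cnj)

text \<open>Multiplication by \<open>cis b - 1\<close> telescopes the sum to a difference of two
  unimodular numbers.\<close>

lemma norm_sum_cis_arith_progression_le:
  assumes "cis b \<noteq> 1"
  shows "norm (\<Sum>n=1..N. cis (a + real n * b)) \<le> 2 / norm (cis b - 1)"
proof -
  have "(\<Sum>n=1..N. cis (a + real n * b)) * (cis b - 1)
      = (\<Sum>n=1..N. cis (a + real (Suc n) * b) - cis (a + real n * b))"
    unfolding sum_distrib_right
    by (intro sum.cong refl) (simp add: algebra_simps cis_mult)
  also have "\<dots> = cis (a + real (Suc N) * b) - cis (a + b)"
    by (subst sum_Suc_diff) simp_all
  finally have "norm (\<Sum>n=1..N. cis (a + real n * b)) * norm (cis b - 1)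
      = norm (cis (a + real (Suc N) * b) - cis (a + b))"
    by (metis norm_mult)
  also have "\<dots> \<le> 2"
    using norm_triangle_ineq4[of "cis (a + real (Suc N) * b)" "cis (a + b)"] by simp
  finally show ?thesis
    using assms by (simp add: pos_le_divide_eq)
qed

text \<open>Each shift by one drops one term and gains another, at a cost of at most 2.\<close>

lemma norm_sum_minus_shifted_sum_le:
  fixes a :: "nat \<Rightarrow> complex"
  assumes unit: "\<And>n. norm (a n) = 1"
  shows "norm ((\<Sum>n=1..N. a n) - (\<Sum>n=1..N. a (n + h))) \<le> 2 * real h"
proof (induction h)
  case 0
  then show ?case by simp
next
  case (Suc h)
  have "(\<Sum>n=1..N. a (n + Suc h)) - (\<Sum>n=1..N. a (n + h)) = a (Suc N + h) - a (Suc h)"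
    using sum_Suc_diff[of 1 N "\<lambda>n. a (n + h)"] by (simp add: sum_subtractf)
  moreover have "norm (a (Suc N + h) - a (Suc h)) \<le> 2"
    using norm_triangle_ineq4[of "a (Suc N + h)" "a (Suc h)"] by (simp add: unit)
  ultimately have "norm ((\<Sum>n=1..N. a (n + Suc h)) - (\<Sum>n=1..N. a (n + h))) \<le> 2"
    by (simp only:)
  then show ?case
    using Suc.IH norm_triangle_ineq4[of "(\<Sum>n=1..N. a n) - (\<Sum>n=1..N. a (n + h))"
        "(\<Sum>n=1..N. a (n + Suc h)) - (\<Sum>n=1..N. a (n + h))"] by simp
qed

text \<open>Conjugation carries the hypothesis from positive to nonzero integers, as differences of
  shifts may have either sign.\<close>

lemma diophantine_cis:
  fixes k :: int
  assumes "diophantine c \<omega>" "k \<noteq> 0"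
  shows "cis (2 * pi * \<omega> * real_of_int k) \<noteq> 1"
    and "1 / norm (cis (2 * pi * \<omega> * real_of_int k) - 1) \<le> c * (real_of_int k)\<^sup>2"
proof -
  let ?l = "nat \<bar>k\<bar>"
  have l: "real ?l = \<bar>real_of_int k\<bar>" "?l \<ge> 1"
    using \<open>k \<noteq> 0\<close> by auto
  have "exp (2 * complex_of_real pi * \<i> * complex_of_real \<omega> * of_nat ?l)
      = cis (2 * pi * \<omega> * \<bar>real_of_int k\<bar>)"
    unfolding cis_conv_exp l(1)[symmetric] by (simp add: mult_ac del: of_nat_nat)
  with assms(1) l have *: "cis (2 * pi * \<omega> * \<bar>real_of_int k\<bar>) \<noteq> 1"
    "1 / norm (cis (2 * pi * \<omega> * \<bar>real_of_int k\<bar>) - 1) \<le> c * (real_of_int k)\<^sup>2"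
    unfolding diophantine_def by (metis, metis power2_abs)
  have n: "norm (cis (2 * pi * \<omega> * \<bar>real_of_int k\<bar>) - 1) = norm (cis (2 * pi * \<omega> * real_of_int k) - 1)"
    using norm_cis_minus_1_neg[of "2 * pi * \<omega> * real_of_int k"] by (simp add: abs_if)
  show "cis (2 * pi * \<omega> * real_of_int k) \<noteq> 1"
    using *(1) n by (metis norm_eq_zero right_minus_eq)
  show "1 / norm (cis (2 * pi * \<omega> * real_of_int k) - 1) \<le> c * (real_of_int k)\<^sup>2"
    using *(2) n by simp
qed

text \<open>With H = K^2 shifts, the mean square costs 3N/K and replacing the sum by its shifts
  costs 2K^2, which is at most 2N/K.\<close>

lemma norm_quadratic_Weyl_sum_le:
  fixes k :: int and N K :: nat
  assumes dio: "diophantine c \<omega>" and "c \<le> A" "1 \<le> A" and k: "k \<noteq> 0" "\<bar>k\<bar> < int K"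
    and N: "A * real K ^ 8 \<le> real N"
  shows "norm (\<Sum>n=1..N. cis (2 * pi * real_of_int k * (\<omega> * (real n)\<^sup>2 - C))) \<le> 5 * real N / real K"
proof -
  define a where "a n = cis (2 * pi * real_of_int k * (\<omega> * (real n)\<^sup>2 - C))" for n :: nat
  define H where "H = K\<^sup>2"
  \<comment> \<open>This is 2A(2KH)^2: the geometric sum gives the outer 2, and the frequency
    \<open>m\<close> below satisfies |m| \<le> 2KH.\<close>
  define B where "B = 8 * A * (real K)\<^sup>2 * (real H)\<^sup>2"
  have K: "1 \<le> K" using k by linarith
  have rK: "1 \<le> real K" using K by simp
  have unit: "norm (a n) = 1" for n by (simp add: a_def)
  have "0 \<le> B" using \<open>1 \<le> A\<close> by (simp add: B_def)
  have off: "norm (\<Sum>n\<in>{1..N}. a (n + i) * cnj (a (n + j))) \<le> B"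
    if ij: "i < H" "j < H" "i \<noteq> j" for i j
  proof -
    define m where "m = 2 * k * (int i - int j)"
    define s where "s = 2 * pi * real_of_int k * \<omega> * ((real i)\<^sup>2 - (real j)\<^sup>2)"
    have "m \<noteq> 0" using ij k by (simp add: m_def)
    \<comment> \<open>The terms in n^2 and \<open>C\<close> cancel, so the phase is linear in
      \<open>n\<close>.\<close>
    have "a (n + i) * cnj (a (n + j)) = cis (s + real n * (2 * pi * \<omega> * real_of_int m))" for n
      unfolding a_def cis_cnj cis_mult s_def m_def
      by (rule arg_cong[of _ _ cis]) (simp add: power2_eq_square algebra_simps)
    then have "norm (\<Sum>n\<in>{1..N}. a (n + i) * cnj (a (n + j)))
        \<le> 2 / norm (cis (2 * pi * \<omega> * real_of_int m) - 1)"
      using norm_sum_cis_arith_progression_le[OF diophantine_cis(1)[OF dio \<open>m \<noteq> 0\<close>]] by simp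
    also have "\<dots> \<le> 2 * (c * (real_of_int m)\<^sup>2)"
      using diophantine_cis(2)[OF dio \<open>m \<noteq> 0\<close>] by simp
    also have "\<dots> \<le> 2 * (A * (real_of_int m)\<^sup>2)"
      using \<open>c \<le> A\<close> by (simp add: mult_right_mono)
    also have "\<dots> \<le> 2 * (A * (2 * real K * real H)\<^sup>2)"
    proof -
      have "\<bar>m\<bar> = 2 * (\<bar>k\<bar> * \<bar>int i - int j\<bar>)" by (simp add: m_def abs_mult)
      also have "\<dots> \<le> 2 * (int K * int H)"
        using k ij by (intro mult_left_mono mult_mono) auto
      finally have "real_of_int \<bar>m\<bar> \<le> real_of_int (2 * (int K * int H))"
        by (simp only: of_int_le_iff)
      then have "(real_of_int m)\<^sup>2 \<le> (2 * real K * real H)\<^sup>2"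
        by (intro power2_le_iff_abs_le[THEN iffD2]) auto
      then show ?thesis using \<open>1 \<le> A\<close> by simp
    qed
    also have "\<dots> = B" by (simp add: B_def power2_eq_square)
    finally show ?thesis .
  qed
  have "(norm (\<Sum>n=1..N. \<Sum>h<H. a (n + h)))\<^sup>2 \<le> (\<Sum>n=1..N. norm (\<Sum>h<H. a (n + h)))\<^sup>2"
    by (intro power_mono norm_sum) simp
  also have "\<dots> \<le> real N * (\<Sum>n=1..N. (norm (\<Sum>h<H. a (n + h)))\<^sup>2)"
    using sum_squared_le_sum_of_squares[of "\<lambda>n. norm (\<Sum>h<H. a (n + h))" "{1..N}"]
    by (simp add: mult.commute)
  also have "\<dots> \<le> real N * (real H * real N + (real H)\<^sup>2 * B)"
    using sum_norm_square_le_offdiagonal[of "\<lambda>h n. a (n + h)" B H "{1..N}"] unit \<open>0 \<le> B\<close> off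
    by (intro mult_left_mono) auto
  \<comment> \<open>The diagonal gives K^2 N^2 and the rest at most 8 K^2 N^2, since A K^8 \<le>
    N.\<close>
  also have "\<dots> \<le> (3 * real N * real K)\<^sup>2"
  proof -
    have "(real H)\<^sup>2 * B = 8 * (real K)\<^sup>2 * (A * real K ^ 8)"
      by (simp add: B_def H_def flip: power_mult power_add)
    also have "\<dots> \<le> 8 * (real K)\<^sup>2 * real N" using N by (intro mult_left_mono) auto
    finally have "real N * (real H * real N + (real H)\<^sup>2 * B)
        \<le> real N * (real H * real N + 8 * (real K)\<^sup>2 * real N)"
      by (intro mult_left_mono) auto
    also have "\<dots> = (3 * real N * real K)\<^sup>2" by (simp add: H_def power2_eq_square)
    finally show ?thesis .
  qed
  finally have avg: "norm (\<Sum>n=1..N. \<Sum>h<H. a (n + h)) \<le> 3 * real N * real K"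
    by (rule power2_le_imp_le) simp
  have "of_nat H * (\<Sum>n=1..N. a n) - (\<Sum>n=1..N. \<Sum>h<H. a (n + h))
      = (\<Sum>h<H. (\<Sum>n=1..N. a n) - (\<Sum>n=1..N. a (n + h)))"
    by (subst sum.swap) (simp add: sum_subtractf)
  also have "norm \<dots> \<le> (\<Sum>h<H. 2 * real H)"
  proof (intro sum_norm_le)
    fix h assume "h \<in> {..<H}"
    then show "norm ((\<Sum>n=1..N. a n) - (\<Sum>n=1..N. a (n + h))) \<le> 2 * real H"
      using norm_sum_minus_shifted_sum_le[of a N h, OF unit] by simp
  qed
  finally have "norm (of_nat H * (\<Sum>n=1..N. a n)) \<le> 2 * real H * real H + 3 * real N * real K"
    using avg norm_triangle_sub[of "of_nat H * (\<Sum>n=1..N. a n)" "\<Sum>n=1..N. \<Sum>h<H. a (n + h)"]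
    by simp
  then have "(real K)\<^sup>2 * norm (\<Sum>n=1..N. a n) \<le> 2 * real K ^ 4 + 3 * real N * real K"
    by (simp add: norm_mult norm_power H_def eval_nat_numeral)
  also have "\<dots> \<le> 5 * real N * real K"
  proof -
    have "real K ^ 3 \<le> real K ^ 8" using rK by (intro power_increasing) auto
    also have "\<dots> \<le> A * real K ^ 8" using \<open>1 \<le> A\<close> mult_right_mono[of 1 A "real K ^ 8"] by simp
    finally have "real K ^ 3 * real K \<le> real N * real K"
      using N by (intro mult_right_mono) linarith+
    then show ?thesis by (simp add: eval_nat_numeral mult_ac)
  qed
  finally show ?thesis
    unfolding a_def using rK by (simp add: field_simps power2_eq_square)
qed

text \<open>All angles, reduced by full turns, lie in [0, \<pi>/3], where the cosine is at least
  1/2.\<close>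

lemma norm_sum_cis_multiples_ge:
  assumes "frac x \<le> \<rho>" "6 * real K * \<rho> \<le> 1"
  shows "real K / 2 \<le> norm (\<Sum>j<K. cis (2 * pi * real j * x))"
proof -
  have "1 / 2 \<le> Re (cis (2 * pi * real j * x))" if "j < K" for j
  proof -
    have "cis (2 * pi * real j * x)
        = cis (2 * pi * real j * frac x) * cis (2 * pi * real_of_int (int j * \<lfloor>x\<rfloor>))"
      unfolding cis_mult by (rule arg_cong[of _ _ cis]) (simp add: frac_def algebra_simps)
    also have "cis (2 * pi * real_of_int (int j * \<lfloor>x\<rfloor>)) = 1"
      by (rule cis_multiple_2pi) (rule Ints_of_int)
    finally have re: "Re (cis (2 * pi * real j * x)) = cos (2 * pi * real j * frac x)" by simp
    have "real j * frac x \<le> real K * \<rho>"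
      using that assms by (intro mult_mono) auto
    then have "6 * (real j * frac x) \<le> 1" using assms(2) by linarith
    then have "pi * (6 * (real j * frac x)) \<le> pi * 1" by (intro mult_left_mono) auto
    then have "2 * pi * real j * frac x \<le> pi / 3" by (simp add: algebra_simps)
    then have "cos (pi / 3) \<le> cos (2 * pi * real j * frac x)"
      by (intro cos_monotone_0_pi_le) auto
    then show ?thesis unfolding re by (simp add: cos_60)
  qed
  then have "(\<Sum>j<K. 1 / 2) \<le> (\<Sum>j<K. Re (cis (2 * pi * real j * x)))"
    by (intro sum_mono) simp
  also have "\<dots> \<le> norm (\<Sum>j<K. cis (2 * pi * real j * x))"
    using complex_Re_le_cmod[of "\<Sum>j<K. cis (2 * pi * real j * x)"] by simp
  finally show ?thesis by simp
qed

text \<open>Each counted \<open>n\<close> contributes at least K^2/4 to a mean square whose total is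
  at most 6KN.\<close>

lemma card_theta_le:
  fixes N K :: nat
  assumes dio: "diophantine c \<omega>" and "c \<le> A" "1 \<le> A" and "1 \<le> K"
    and N: "A * real K ^ 8 \<le> real N" and \<rho>: "6 * real K * \<rho> \<le> 1"
  shows "real (card {n\<in>{1..N}. theta \<omega> C n \<in> {0..\<rho>}}) \<le> 24 * real N / real K"
proof -
  define f where "f j n = cis (2 * pi * real j * (\<omega> * (real n)\<^sup>2 - C))" for j n :: nat
  let ?S = "{n\<in>{1..N}. theta \<omega> C n \<in> {0..\<rho>}}"
  have off: "norm (\<Sum>n\<in>{1..N}. f i n * cnj (f j n)) \<le> 5 * real N / real K"
    if "i < K" "j < K" "i \<noteq> j" for i j
  proof -
    have "f i n * cnj (f j n)
        = cis (2 * pi * real_of_int (int i - int j) * (\<omega> * (real n)\<^sup>2 - C))" for n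
      unfolding f_def cis_cnj cis_mult by (rule arg_cong[of _ _ cis]) (simp add: algebra_simps)
    then show ?thesis
      using norm_quadratic_Weyl_sum_le[OF dio assms(2,3) _ _ N, of "int i - int j" C] that by simp
  qed
  have "real (card ?S) * (real K / 2)\<^sup>2 \<le> (\<Sum>n\<in>?S. (norm (\<Sum>j<K. f j n))\<^sup>2)"
    unfolding sum_constant[symmetric] f_def
    by (intro sum_mono power_mono norm_sum_cis_multiples_ge[OF _ \<rho>]) (auto simp: theta_def)
  also have "\<dots> \<le> (\<Sum>n=1..N. (norm (\<Sum>j<K. f j n))\<^sup>2)"
    by (intro sum_mono2) auto
  also have "\<dots> \<le> real K * real N + (real K)\<^sup>2 * (5 * real N / real K)"
    using sum_norm_square_le_offdiagonal[of f "5 * real N / real K" K "{1..N}"] off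
    by (simp add: f_def)
  also have "\<dots> = 6 * real K * real N" using \<open>1 \<le> K\<close> by (simp add: power2_eq_square)
  finally show ?thesis using \<open>1 \<le> K\<close> by (simp add: field_simps power2_eq_square)
qed

theorem propositionE1:
  fixes c\<^sub>1 :: real
  shows "\<exists>c::real. \<forall>\<omega>\<^sub>0 C :: real. diophantine c\<^sub>1 \<omega>\<^sub>0 \<longrightarrow>
           (\<forall>\<rho>::real. \<forall>N::nat. 0 < \<rho> \<and> \<rho> < 1/4 \<and> real N > \<rho> powr (-78) \<longrightarrow>
              1 / real N * (\<Sum>n\<in>{n\<in>{1..N}. theta \<omega>\<^sub>0 C n \<in> {0..\<rho>}}. 1) \<le> c * \<rho>)"
proof -
  \<comment> \<open>\<open>A\<close> depends only on \<open>c\<^sub>1\<close>, hence so does the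
    final constant \<open>288 + A\<close>.\<close>
  define A where "A = max 1 c\<^sub>1"
  have A: "1 \<le> A" "c\<^sub>1 \<le> A" by (auto simp: A_def)
  have "1 / real N * (\<Sum>n\<in>{n\<in>{1..N}. theta \<omega> C n \<in> {0..\<rho>}}. 1) \<le> (288 + A) * \<rho>"
    if dio: "diophantine c\<^sub>1 \<omega>" and \<rho>: "0 < \<rho>" and N: "real N > \<rho> powr (-78)" for \<omega> C \<rho> N
  proof -
    let ?S = "{n\<in>{1..N}. theta \<omega> C n \<in> {0..\<rho>}}"
    have N0: "0 < real N" using N powr_ge_zero[of \<rho> "-78"] by linarith
    show ?thesis
    proof (cases "\<rho> \<le> 1/6 \<and> A * \<rho> \<le> 1")
      \<comment> \<open>Here \<rho> is bounded below in terms of \<open>A\<close>, and the trivial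
        bound 1 for the density suffices.\<close>
      case False
      have "card ?S \<le> card {1..N}" by (intro card_mono) auto
      then have "real (card ?S) \<le> real N" by simp
      then have "1 / real N * (\<Sum>n\<in>?S. 1) \<le> 1" using N0 by (simp add: field_simps)
      also have "1 \<le> 6 * \<rho> + A * \<rho>"
        using False A(1) \<rho> mult_pos_pos[of A \<rho>] by linarith
      also have "\<dots> \<le> (288 + A) * \<rho>" using \<rho> by (simp add: algebra_simps)
      finally show ?thesis .
    next
      case True
      \<comment> \<open>The largest integer with 6K\<rho> \<le> 1; it is positive because \<rho>
        \<le> 1/6.\<close>
      define K where "K = nat \<lfloor>1 / (6 * \<rho>)\<rfloor>"
      have ge1: "1 \<le> 1 / (6 * \<rho>)" using True \<rho> by (simp add: field_simps)
      then have K1: "1 \<le> K" unfolding K_def by linarith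
      have Kle: "real K \<le> 1 / (6 * \<rho>)" and Kgt: "1 / (6 * \<rho>) < real K + 1"
        unfolding K_def using ge1 by linarith+
      \<comment> \<open>One factor 1/\<rho> absorbs \<open>A\<close>, and the other eight dominate
        K^8.\<close>
      have "A * real K ^ 8 \<le> (1 / \<rho>) * (1 / \<rho>) ^ 8"
      proof (intro mult_mono power_mono)
        show "A \<le> 1 / \<rho>" using True \<rho> by (simp add: field_simps)
        show "real K \<le> 1 / \<rho>" using Kle \<rho> by (simp add: field_simps)
      qed (use \<rho> in auto)
      also have "\<dots> = (1 / \<rho>) ^ 9" by (simp add: eval_nat_numeral)
      also have "\<dots> \<le> (1 / \<rho>) ^ 78" using True \<rho> by (intro power_increasing) auto
      also have "\<dots> = \<rho> powr (-78)"
        using \<rho> powr_realpow[of \<rho> 78] by (simp add: powr_minus divide_simps power_divide)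
      finally have NK: "A * real K ^ 8 \<le> real N" using N by linarith
      have "6 * real K * \<rho> \<le> 1" using Kle \<rho> by (simp add: field_simps)
      from card_theta_le[OF dio A(2,1) K1 NK this, of C]
      have "1 / real N * (\<Sum>n\<in>?S. 1) \<le> 24 / real K"
        using N0 K1 by (simp add: field_simps)
      \<comment> \<open>Rounding down at most halves 1/(6\<rho>), so 1/K \<le> 12\<rho>, and 288 =
        24 * 12.\<close>
      also have "1 / (6 * \<rho>) \<le> 2 * real K" using Kgt K1 by linarith
      then have "24 / real K \<le> 288 * \<rho>" using K1 \<rho> by (simp add: field_simps)
      also have "\<dots> \<le> (288 + A) * \<rho>" using \<rho> A by (simp add: algebra_simps)
      finally show ?thesis .
    qed
  qed
  then show ?thesis by blast
qed

end
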